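(* Let $X$ be a nonempty set, let $f\in\ell^{\infty}(X)$, and for each $n\in\mathbb{N}$ let $\hat f_n\in\ell^{\infty}(X)$ be arbitrary. Put $$\psi^{*}=\inf_{x\in X}f(x),\quad \hat\psi_n=\inf_{x\in X}\hat f_n(x),\quad \Delta_n=\lVert \hat f_n-f\rVert_\infty,$$ and for $\varepsilon,\delta\ge 0$ $$S^{\varepsilon}=\{x\in X: f(x)\le\psi^{*}+\varepsilon\},\qquad \hat S_n^{\delta}=\{x\in X:\hat f_n(x)\le\hat\psi_n+\delta\}.$$ Then for every $n$ and every $\varepsilon,\delta\ge0$ the following hold. (a) $\lvert\hat\psi_n-\psi^{*}\rvert\le\Delta_n$. (b) $\hat S_n^{\delta}\subseteq S^{2\Delta_n+\delta}$ and $S^{\varepsilon}\subseteq\hat S_n^{2\Delta_n+\varepsilon}$. (c) If $\hat x_n\in\hat S_n^{\delta}$, then $f(\hat x_n)-\psi^{*}\le 2\Delta_n+\delta$. (d) If $X\subseteq\mathbb{R}^d$, $S^{0}\neq\varnothing$, $\kappa\ge1$, and $\alpha>0$ is such that $$f(x)-\psi^{*}\ge\alpha\,\operatorname{dist}(x,S^{0})^{\kappa}\qquad\text{for all }x\in X,$$ then every $\hat x_n\in\hat S_n^{\delta}$ satisfies $$\operatorname{dist}(\hat x_n,S^{0})^{\kappa}\le\alpha^{-1}(2\Delta_n+\delta).$$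
   Context: $\ell^{\infty}(X)$ is the Banach space of all bounded real-valued functions on $X$ with the supremum norm $\lVert g\rVert_\infty=\sup_{x\in X}|g(x)|$. For $X\subseteq\mathbb{R}^d$, $\operatorname{dist}(x,A)=\inf_{a\in A}\lVert x-a\rVert$ is the Euclidean distance. *)

theory Defs
  imports "HOL-Analysis.Analysis"
begin

text \<open>
  A real-valued function on \<open>X\<close> is represented by a total function on the ambient type, of which
  only the values on \<open>X\<close> are ever used.
\<close>

definition linf :: "'a set \<Rightarrow> ('a \<Rightarrow> real) set" where
  "linf X = {g. bounded (g ` X)}"

text \<open>The supremum is meaningful for \<open>X \<noteq> {}\<close> and \<open>g \<in> linf X\<close>.\<close>

definition sup_norm :: "'a set \<Rightarrow> ('a \<Rightarrow> real) \<Rightarrow> real" where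
  "sup_norm X g = (SUP x\<in>X. \<bar>g x\<bar>)"

definition near_min :: "'a set \<Rightarrow> ('a \<Rightarrow> real) \<Rightarrow> real \<Rightarrow> 'a set" where
  "near_min X g \<epsilon> = {x \<in> X. g x \<le> (INF y\<in>X. g y) + \<epsilon>}"

end

theory Submission
  imports Defs
begin

text \<open>Write g for the perturbed function and \<Delta> for
  \<open>sup_norm X (\<lambda>x. g x - f x)\<close>. Everything rests on the pointwise bound \<bar>g
  x - f x\<bar> \<le> \<Delta> (\<open>abs_le_sup_norm\<close>). Passing to infima costs at most
  \<Delta> (\<open>INF_le_INF_add_sup_norm\<close>), and since \<Delta> is symmetric in f and g,
  each one-sided estimate can be used in both directions. A near-minimiser of g then pays \<Delta>
  twice, once for replacing g x by f x and once for replacing the infimum of g by that of f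
  (\<open>near_min_subset\<close>). The bound on the excess of f is membership in the enlarged level
  set, and the distance bound follows by chaining it with the growth condition and dividing by
  \<alpha>.\<close>

lemma linf_diff:
  assumes "f \<in> linf X" "g \<in> linf X"
  shows "(\<lambda>x. g x - f x) \<in> linf X"
  using assms bounded_minus_comp[of g X f] by (simp add: linf_def)

lemma linf_bdd_below:
  assumes "f \<in> linf X"
  shows "bdd_below (f ` X)"
  using assms by (simp add: linf_def bounded_imp_bdd_below)

text \<open>Boundedness of g is what makes the real-valued \<open>SUP\<close> a genuine upper
  bound.\<close>

lemma abs_le_sup_norm:
  assumes "g \<in> linf X" "x \<in> X"
  shows "\<bar>g x\<bar> \<le> sup_norm X g"
proof -
  have "bounded (g ` X)"
    using assms(1) by (simp add: linf_def)
  then obtain B where "\<forall>y\<in>X. \<bar>g y\<bar> \<le> B"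
    by (auto simp: bounded_iff)
  then have "bdd_above ((\<lambda>x. \<bar>g x\<bar>) ` X)"
    by (auto intro!: bdd_aboveI)
  with assms(2) show ?thesis
    unfolding sup_norm_def by (rule cSUP_upper)
qed

lemma sup_norm_diff_commute: "sup_norm X (\<lambda>x. g x - f x) = sup_norm X (\<lambda>x. f x - g x)"
  by (simp add: sup_norm_def abs_minus_commute)

text \<open>The number inf g - \<Delta> is a lower bound of f on X, because inf g \<le> g x \<le> f
  x + \<Delta> at each point; so it lies below the greatest lower bound.\<close>

lemma INF_le_INF_add_sup_norm:
  assumes "X \<noteq> {}" "f \<in> linf X" "g \<in> linf X"
  shows "(INF x\<in>X. g x) \<le> (INF x\<in>X. f x) + sup_norm X (\<lambda>x. g x - f x)"
proof -
  have "(INF x\<in>X. g x) - sup_norm X (\<lambda>x. g x - f x) \<le> f x" if "x \<in> X" for x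
    using abs_le_sup_norm[OF linf_diff[OF assms(2,3)] that]
      cINF_lower[OF linf_bdd_below[OF assms(3)] that] by linarith
  then have "(INF x\<in>X. g x) - sup_norm X (\<lambda>x. g x - f x) \<le> (INF x\<in>X. f x)"
    by (intro cINF_greatest assms(1))
  then show ?thesis by linarith
qed

lemma abs_INF_diff_le_sup_norm:
  assumes "X \<noteq> {}" "f \<in> linf X" "g \<in> linf X"
  shows "\<bar>(INF x\<in>X. g x) - (INF x\<in>X. f x)\<bar> \<le> sup_norm X (\<lambda>x. g x - f x)"
  using INF_le_INF_add_sup_norm[OF assms] INF_le_INF_add_sup_norm[OF assms(1,3,2)]
    sup_norm_diff_commute[of X g f] by linarith

lemma near_min_subset:
  assumes "X \<noteq> {}" "f \<in> linf X" "g \<in> linf X"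
  shows "near_min X g \<delta> \<subseteq> near_min X f (2 * sup_norm X (\<lambda>x. g x - f x) + \<delta>)"
proof
  fix x assume "x \<in> near_min X g \<delta>"
  then have x: "x \<in> X" and gx: "g x \<le> (INF y\<in>X. g y) + \<delta>"
    by (auto simp: near_min_def)
  \<comment> \<open>The chain is f x \<le> g x + \<Delta> \<le> inf g + \<delta> + \<Delta> \<le>
    inf f + 2 * \<Delta> + \<delta>.\<close>
  have "f x \<le> (INF y\<in>X. f y) + (2 * sup_norm X (\<lambda>x. g x - f x) + \<delta>)"
    using gx abs_le_sup_norm[OF linf_diff[OF assms(2,3)] x] INF_le_INF_add_sup_norm[OF assms]
    by linarith
  with x show "x \<in> near_min X f (2 * sup_norm X (\<lambda>x. g x - f x) + \<delta>)"
    by (simp add: near_min_def)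
qed

lemma near_min_excess_le:
  assumes "X \<noteq> {}" "f \<in> linf X" "g \<in> linf X" "x \<in> near_min X g \<delta>"
  shows "f x - (INF y\<in>X. f y) \<le> 2 * sup_norm X (\<lambda>x. g x - f x) + \<delta>"
  using near_min_subset[OF assms(1-3)] assms(4) by (fastforce simp: near_min_def)

text \<open>The function h stands for the \<kappa>-th power of the distance to the minimisers. The
  argument sees it only through the growth inequality, so it works on any type.\<close>

lemma near_min_growth_le:
  fixes f g h :: "'a \<Rightarrow> real"
  assumes "X \<noteq> {}" "f \<in> linf X" "g \<in> linf X" "x \<in> near_min X g \<delta>" "\<alpha> > 0"
    and growth: "\<forall>x\<in>X. f x - (INF y\<in>X. f y) \<ge> \<alpha> * h x"
  shows "h x \<le> inverse \<alpha> * (2 * sup_norm X (\<lambda>x. g x - f x) + \<delta>)"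
proof -
  have "x \<in> X" using assms(4) by (simp add: near_min_def)
  then have "\<alpha> * h x \<le> 2 * sup_norm X (\<lambda>x. g x - f x) + \<delta>"
    using growth near_min_excess_le[OF assms(1-4)] by fastforce
  with \<open>\<alpha> > 0\<close> show ?thesis by (simp add: field_simps)
qed

theorem theorem4p1:
  shows "(\<forall>(X :: 'a set) (f :: 'a \<Rightarrow> real) (fhat :: nat \<Rightarrow> 'a \<Rightarrow> real).
      X \<noteq> {} \<longrightarrow> f \<in> linf X \<longrightarrow> (\<forall>n. fhat n \<in> linf X) \<longrightarrow>
      (\<forall>(n::nat) (\<epsilon>::real) (\<delta>::real). \<epsilon> \<ge> 0 \<longrightarrow> \<delta> \<ge> 0 \<longrightarrow>
        (let \<psi> = (INF x\<in>X. f x);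
             \<psi>hat = (INF x\<in>X. fhat n x);
             \<Delta> = sup_norm X (\<lambda>x. fhat n x - f x)
         in \<bar>\<psi>hat - \<psi>\<bar> \<le> \<Delta>
          \<and> near_min X (fhat n) \<delta> \<subseteq> near_min X f (2 * \<Delta> + \<delta>)
          \<and> near_min X f \<epsilon> \<subseteq> near_min X (fhat n) (2 * \<Delta> + \<epsilon>)
          \<and> (\<forall>xhat \<in> near_min X (fhat n) \<delta>. f xhat - \<psi> \<le> 2 * \<Delta> + \<delta>))))
    \<and>
    (\<forall>(X :: (real ^ 'd) set) (f :: real ^ 'd \<Rightarrow> real) (fhat :: nat \<Rightarrow> real ^ 'd \<Rightarrow> real).
      X \<noteq> {} \<longrightarrow> f \<in> linf X \<longrightarrow> (\<forall>n. fhat n \<in> linf X) \<longrightarrow>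
      (\<forall>(n::nat) (\<delta>::real) (\<kappa>::real) (\<alpha>::real). \<delta> \<ge> 0 \<longrightarrow>
        near_min X f 0 \<noteq> {} \<longrightarrow> \<kappa> \<ge> 1 \<longrightarrow> \<alpha> > 0 \<longrightarrow>
        (let \<psi> = (INF x\<in>X. f x);
             \<Delta> = sup_norm X (\<lambda>x. fhat n x - f x);
             S0 = near_min X f 0
         in (\<forall>x\<in>X. f x - \<psi> \<ge> \<alpha> * infdist x S0 powr \<kappa>) \<longrightarrow>
            (\<forall>xhat \<in> near_min X (fhat n) \<delta>.
               infdist xhat S0 powr \<kappa> \<le> inverse \<alpha> * (2 * \<Delta> + \<delta>)))))"
  unfolding Let_def
proof (intro conjI allI impI ballI)
  fix X :: "'a set" and f :: "'a \<Rightarrow> real" and fhat :: "nat \<Rightarrow> 'a \<Rightarrow> real"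
    and n :: nat and \<epsilon> \<delta> :: real
  assume X: "X \<noteq> {}" and f: "f \<in> linf X" and "\<forall>n. fhat n \<in> linf X"
  then have g: "fhat n \<in> linf X" by blast
  let ?\<Delta> = "sup_norm X (\<lambda>x. fhat n x - f x)"
  show "\<bar>(INF x\<in>X. fhat n x) - (INF x\<in>X. f x)\<bar> \<le> ?\<Delta>"
    by (rule abs_INF_diff_le_sup_norm[OF X f g])
  show "near_min X (fhat n) \<delta> \<subseteq> near_min X f (2 * ?\<Delta> + \<delta>)"
    by (rule near_min_subset[OF X f g])
  \<comment> \<open>This is the previous inclusion with f and \<open>fhat n\<close> exchanged and
    \<epsilon> as the slack; symmetry of the norm of the difference restores the same
    \<Delta>.\<close>
  show "near_min X f \<epsilon> \<subseteq> near_min X (fhat n) (2 * ?\<Delta> + \<epsilon>)"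
    using near_min_subset[OF X g f] by (simp add: sup_norm_diff_commute[of X f])
  show "f x - (INF x\<in>X. f x) \<le> 2 * ?\<Delta> + \<delta>" if "x \<in> near_min X (fhat n) \<delta>" for x
    by (rule near_min_excess_le[OF X f g that])
next
  fix X :: "(real ^ 'd) set" and f :: "real ^ 'd \<Rightarrow> real" and fhat :: "nat \<Rightarrow> real ^ 'd \<Rightarrow> real"
    and n :: nat and \<delta> \<kappa> \<alpha> :: real and x :: "real ^ 'd"
  assume "X \<noteq> {}" "f \<in> linf X" "\<forall>n. fhat n \<in> linf X" "\<alpha> > 0" "x \<in> near_min X (fhat n) \<delta>"
    "\<forall>x\<in>X. f x - (INF x\<in>X. f x) \<ge> \<alpha> * infdist x (near_min X f 0) powr \<kappa>"
  then show "infdist x (near_min X f 0) powr \<kappa>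
      \<le> inverse \<alpha> * (2 * sup_norm X (\<lambda>x. fhat n x - f x) + \<delta>)"
    by (intro near_min_growth_le[where h = "\<lambda>x. infdist x (near_min X f 0) powr \<kappa>"]) auto
qed

end
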